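(* Let $n\ge 1$, let $L(s)=\sum_{k=1}^{\infty}a_k k^{-s}$ be a formal Dirichlet series with complex coefficients and $a_1=1$, and write its formal inverse as $L(s)^{-1}=\sum_{k=1}^{\infty}b_k k^{-s}$. Let $D_n$ be the $n\times n$ matrix whose $(i,j)$ entry is $a_{j/i}$ if $i\mid j$ and $0$ otherwise. Let $w_2,\dots,w_n$ be complex numbers, put $w_1=1$, and let $W_n$ be the $n\times n$ matrix whose first column is $(0,w_2,\dots,w_n)^T$ and whose other entries are zero. Let $A_n=W_n+D_n$ and $\tilde A_n=W_n+D_n^{-1}$. Then $$\det(A_n)=\sum_{k=1}^{n}w_k b_k\qquad\text{and}\qquad \det(\tilde A_n)=\sum_{k=1}^{n}w_k a_k .$$
   Context: Formal Dirichlet series multiply by Dirichlet convolution of coefficients; a formal Dirichlet series with $a_1=1$ has a unique formal inverse, i.e. $b_1=1$ and $\sum_{d\mid m}a_d b_{m/d}=0$ for all $m>1$. The matrix $D_n$ is upper triangular with $1$'s on the diagonal, hence invertible. *)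

theory Defs
  imports "Jordan_Normal_Form.Gauss_Jordan_Elimination" "Jordan_Normal_Form.Determinant"
begin

text \<open>
  A formal Dirichlet series is represented by its coefficient sequence of type
  \<open>nat \<Rightarrow> complex\<close>, of which only the values at indices \<open>\<ge> 1\<close> are meaningful;
  the value at \<open>0\<close> is never constrained.
\<close>

definition dirichlet_conv :: "(nat \<Rightarrow> complex) \<Rightarrow> (nat \<Rightarrow> complex) \<Rightarrow> nat \<Rightarrow> complex" where
  "dirichlet_conv a b m = (\<Sum>d | d dvd m. a d * b (m div d))"

definition is_dirichlet_inverse :: "(nat \<Rightarrow> complex) \<Rightarrow> (nat \<Rightarrow> complex) \<Rightarrow> bool" where
  "is_dirichlet_inverse a b \<longleftrightarrow>
     (\<forall>m\<ge>1. dirichlet_conv a b m = (if m = 1 then 1 else 0))"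

lemma dirichlet_conv_split:
  assumes "m \<ge> 1"
  shows "dirichlet_conv a b m = a 1 * b m + (\<Sum>d | d dvd m \<and> 1 < d. a d * b (m div d))"
proof -
  have "{d. d dvd m} = insert 1 {d. d dvd m \<and> 1 < d}"
  proof (intro equalityI subsetI)
    fix d assume "d \<in> {d. d dvd m}"
    then have "d dvd m" by simp
    moreover from this have "d > 0"
      using assms dvd_pos_nat[of m d] by simp
    ultimately show "d \<in> insert 1 {d. d dvd m \<and> 1 < d}"
      by (cases "d = 1") simp_all
  qed auto
  moreover have "finite {d. d dvd m \<and> 1 < d}"
    using assms by simp
  ultimately show ?thesis
    by (simp add: dirichlet_conv_def)
qed

lemma is_dirichlet_inverse_alt:
  assumes "a 1 = 1"
  shows "is_dirichlet_inverse a b \<longleftrightarrow>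
           b 1 = 1 \<and> (\<forall>m>1. (\<Sum>d | d dvd m. a d * b (m div d)) = 0)"
proof -
  have "dirichlet_conv a b 1 = b 1"
    using assms by (simp add: dirichlet_conv_def)
  moreover have "(\<forall>m\<ge>1. P m) \<longleftrightarrow> P 1 \<and> (\<forall>m>1. P m)" for P :: "nat \<Rightarrow> bool"
    by (metis le_neq_implies_less less_imp_le order_refl)
  ultimately show ?thesis
    using assms by (simp add: is_dirichlet_inverse_def dirichlet_conv_def)
qed

function dirichlet_inverse_coeff :: "(nat \<Rightarrow> complex) \<Rightarrow> nat \<Rightarrow> complex" where
  "dirichlet_inverse_coeff a m =
     (if m \<le> 1 then 1
      else - (\<Sum>d\<in>{d. d dvd m \<and> 1 < d}. a d * dirichlet_inverse_coeff a (m div d)))"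
  by auto
termination
  by (relation "measure snd") simp_all

declare dirichlet_inverse_coeff.simps [simp del]

lemma is_dirichlet_inverse_exists:
  assumes "a 1 = 1"
  shows "is_dirichlet_inverse a (dirichlet_inverse_coeff a)"
  unfolding is_dirichlet_inverse_def
proof (intro allI impI)
  fix m :: nat assume "m \<ge> 1"
  show "dirichlet_conv a (dirichlet_inverse_coeff a) m = (if m = 1 then 1 else 0)"
  proof (cases "m = 1")
    case True
    have "{d::nat. d dvd 1} = {1}" by auto
    then have "dirichlet_conv a (dirichlet_inverse_coeff a) 1 = a 1 * dirichlet_inverse_coeff a 1"
      by (simp only: dirichlet_conv_def) simp
    then show ?thesis
      using True assms by (simp add: dirichlet_inverse_coeff.simps[of a "Suc 0"])
  next
    case False
    then have "\<not> m \<le> 1" using \<open>m \<ge> 1\<close> by simp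
    then have "dirichlet_inverse_coeff a m =
        - (\<Sum>d\<in>{d. d dvd m \<and> 1 < d}. a d * dirichlet_inverse_coeff a (m div d))"
      by (subst dirichlet_inverse_coeff.simps) (simp only: if_False)
    then show ?thesis
      unfolding dirichlet_conv_split[OF \<open>m \<ge> 1\<close>] using False assms by simp
  qed
qed

lemma is_dirichlet_inverse_unique:
  assumes "a 1 = 1" "is_dirichlet_inverse a b" "is_dirichlet_inverse a c" "m \<ge> 1"
  shows "b m = c m"
  using assms(4)
proof (induction m rule: less_induct)
  case (less m)
  have "(\<Sum>d | d dvd m \<and> 1 < d. a d * b (m div d)) = (\<Sum>d | d dvd m \<and> 1 < d. a d * c (m div d))"
    using less.prems by (intro sum.cong) (auto intro!: less.IH dvd_imp_le simp: div_greater_zero_iff Suc_le_eq)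
  moreover have "dirichlet_conv a b m = dirichlet_conv a c m"
    using assms(2,3) less.prems by (simp add: is_dirichlet_inverse_def)
  ultimately show ?case
    using less.prems assms(1) by (simp add: dirichlet_conv_split)
qed

text \<open>Matrix indices of \<^const>\<open>mat\<close> start at \<open>0\<close>, so the classical entry \<open>(i, j)\<close> sits at \<open>(i - 1, j - 1)\<close>.\<close>

definition D_mat :: "nat \<Rightarrow> (nat \<Rightarrow> complex) \<Rightarrow> complex mat" where
  "D_mat n a = mat n n (\<lambda>(i, j). if Suc i dvd Suc j then a (Suc j div Suc i) else 0)"

definition W_mat :: "nat \<Rightarrow> (nat \<Rightarrow> complex) \<Rightarrow> complex mat" where
  "W_mat n w = mat n n (\<lambda>(i, j). if j = 0 \<and> i \<noteq> 0 then w (Suc i) else 0)"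

text \<open>\<^const>\<open>mat_inverse\<close> is option-valued; on these matrices it always returns the two-sided inverse.\<close>

lemma mat_inverse_D_mat:
  assumes "a 1 = 1"
  obtains E where "mat_inverse (D_mat n a) = Some E" "E \<in> carrier_mat n n"
    "D_mat n a * E = 1\<^sub>m n" "E * D_mat n a = 1\<^sub>m n"
proof -
  have car: "D_mat n a \<in> carrier_mat n n"
    by (simp add: D_mat_def)
  have "upper_triangular (D_mat n a)"
  proof
    fix i j assume "j < i" "i < dim_row (D_mat n a)"
    moreover from \<open>j < i\<close> have "\<not> Suc i dvd Suc j"
      by (intro nat_dvd_not_less) simp_all
    ultimately show "D_mat n a $$ (i, j) = 0"
      by (simp add: D_mat_def)
  qed
  then have "det (D_mat n a) = prod_list (diag_mat (D_mat n a))"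
    using car by (rule det_upper_triangular)
  also have "diag_mat (D_mat n a) = map (\<lambda>_. 1) [0..<n]"
    unfolding diag_mat_def using assms by (intro map_cong) (simp_all add: D_mat_def)
  finally have "det (D_mat n a) \<noteq> 0"
    by (simp add: map_replicate_const)
  then have "D_mat n a \<in> Units (ring_mat TYPE(complex) n n)"
    by (rule det_non_zero_imp_unit[OF car])
  then obtain E where E: "mat_inverse (D_mat n a) = Some E"
    using mat_inverse(1)[OF car, of n] by (cases "mat_inverse (D_mat n a)") simp_all
  then show thesis
    using that mat_inverse(2)[OF car E] E by simp
qed

end

(* Dirichlet convolution turns into matrix multiplication under D, so D_b is the inverse of D_a.
   Multiplying W + D_a on the left by D_b, which has determinant 1, gives D_b W + 1; as W has only
   its first column, this is lower triangular, with diagonal (w_1 b_1 + ... + w_n b_n, 1, ..., 1).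
   The second identity is the first one with a and b exchanged. *)

theory Submission
  imports Defs
begin

lemma D_mat_carrier [simp]: "D_mat n a \<in> carrier_mat n n"
  by (simp add: D_mat_def)

lemma W_mat_carrier [simp]: "W_mat n w \<in> carrier_mat n n"
  by (simp add: W_mat_def)

text \<open>Sending a divisor d of m to m div d is an involution on the divisors that swaps the two
  factors.\<close>

lemma dirichlet_conv_commute:
  assumes "m \<ge> 1"
  shows "dirichlet_conv a b m = dirichlet_conv b a m"
  unfolding dirichlet_conv_def
  by (rule sum.reindex_bij_witness[where i = "\<lambda>d. m div d" and j = "\<lambda>d. m div d"])
    (use assms in \<open>auto elim!: dvdE\<close>)

lemma is_dirichlet_inverse_sym:
  "is_dirichlet_inverse a b \<longleftrightarrow> is_dirichlet_inverse b a"
  by (simp add: is_dirichlet_inverse_def dirichlet_conv_commute[of _ a b])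

text \<open>In classical indices, entry (i, j) of the product sums over the k with i | k | j;
  writing k = i * d turns this into the sum over the divisors d of j / i.\<close>

lemma D_mat_mult: "D_mat n a * D_mat n b = D_mat n (dirichlet_conv a b)"
proof (rule eq_matI)
  fix i j assume "i < dim_row (D_mat n (dirichlet_conv a b))"
    "j < dim_col (D_mat n (dirichlet_conv a b))"
  then have i: "i < n" and j: "j < n"
    by (simp_all add: D_mat_def)
  let ?f = "\<lambda>k. (if Suc i dvd k then a (k div Suc i) else 0) *
                 (if k dvd Suc j then b (Suc j div k) else 0)"
  have "(D_mat n a * D_mat n b) $$ (i, j) = (\<Sum>k = 0..<n. ?f (Suc k))"
    using i j by (simp add: D_mat_def scalar_prod_def)
  also have "\<dots> = (\<Sum>k\<in>{1..n}. ?f k)"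
    by (rule sum.reindex_bij_witness[where i = "\<lambda>k. k - 1" and j = Suc]) auto
  also have "\<dots> = (\<Sum>k | Suc i dvd k \<and> k dvd Suc j. ?f k)"
  proof (rule sum.mono_neutral_right)
    show "{k. Suc i dvd k \<and> k dvd Suc j} \<subseteq> {1..n}"
    proof
      fix k assume "k \<in> {k. Suc i dvd k \<and> k dvd Suc j}"
      then have "k dvd Suc j" by simp
      then show "k \<in> {1..n}"
        using j dvd_imp_le[of k "Suc j"] dvd_pos_nat[of "Suc j" k] by simp
    qed
  qed auto
  also have "\<dots> = D_mat n (dirichlet_conv a b) $$ (i, j)"
  proof (cases "Suc i dvd Suc j")
    case True
    then obtain m where m: "Suc j = Suc i * m" by (rule dvdE)
    then have div: "Suc j div Suc i = m" by (metis nonzero_mult_div_cancel_left nat.distinct(1))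
    have "(\<Sum>k | Suc i dvd k \<and> k dvd Suc j. ?f k) = (\<Sum>d | d dvd m. a d * b (m div d))"
    proof (rule sum.reindex_bij_witness[where i = "\<lambda>d. Suc i * d" and j = "\<lambda>k. k div Suc i"])
      fix k assume "k \<in> {k. Suc i dvd k \<and> k dvd Suc j}"
      \<comment> \<open>Expanding \<open>Suc i * d\<close> by \<open>mult_Suc\<close> would hide the
        common factor that has to cancel.\<close>
      then obtain d where k: "k = Suc i * d" "Suc i * d dvd Suc i * m"
        unfolding m by (auto elim: dvdE simp del: mult_Suc)
      then have kd: "k div Suc i = d" and d: "d dvd m"
        by (simp_all del: mult_Suc)
      show "Suc i * (k div Suc i) = k" "k div Suc i \<in> {d. d dvd m}"
        using kd k(1) d by simp_all
      show "a (k div Suc i) * b (m div (k div Suc i)) = ?f k"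
        unfolding m kd unfolding k(1) using d by (simp del: mult_Suc)
    qed (simp_all add: m del: mult_Suc)
    then show ?thesis
      using i j True by (simp add: D_mat_def dirichlet_conv_def div)
  next
    case False
    then have "{k. Suc i dvd k \<and> k dvd Suc j} = {}"
      using dvd_trans by blast
    then have "(\<Sum>k | Suc i dvd k \<and> k dvd Suc j. ?f k) = 0"
      by (simp only: sum.empty)
    with False i j show ?thesis
      by (simp add: D_mat_def)
  qed
  finally show "(D_mat n a * D_mat n b) $$ (i, j) = D_mat n (dirichlet_conv a b) $$ (i, j)" .
qed (simp_all add: D_mat_def)

lemma D_mat_mult_inverse:
  assumes "is_dirichlet_inverse a b"
  shows "D_mat n a * D_mat n b = 1\<^sub>m n"
proof -
  have "D_mat n (dirichlet_conv a b) = 1\<^sub>m n"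
  proof (rule eq_matI)
    fix i j assume "i < dim_row (1\<^sub>m n :: complex mat)" "j < dim_col (1\<^sub>m n :: complex mat)"
    moreover have "dirichlet_conv a b (Suc j div Suc i) = (if i = j then 1 else 0)"
      if "Suc i dvd Suc j"
    proof -
      from that obtain m where m: "Suc j = Suc i * m" by (rule dvdE)
      then have "Suc j div Suc i = m" by (metis nonzero_mult_div_cancel_left nat.distinct(1))
      \<comment> \<open>The inverse property speaks only of positive indices.\<close>
      moreover have "m \<ge> 1" using m by (cases m) auto
      moreover have "m = 1 \<longleftrightarrow> i = j"
        using m by (metis Suc_inject mult.right_neutral mult_cancel_left nat.distinct(1))
      ultimately show ?thesis
        using assms by (simp add: is_dirichlet_inverse_def)
    qed
    ultimately show "D_mat n (dirichlet_conv a b) $$ (i, j) = 1\<^sub>m n $$ (i, j)"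
      by (auto simp: D_mat_def)
  qed (simp_all add: D_mat_def)
  then show ?thesis by (simp add: D_mat_mult)
qed

text \<open>Below the diagonal a larger number would have to divide a smaller positive one; on it
  every quotient is 1.\<close>

lemma det_D_mat: "det (D_mat n a) = a 1 ^ n"
proof -
  have "upper_triangular (D_mat n a)"
  proof
    fix i j assume "j < i" "i < dim_row (D_mat n a)"
    moreover from \<open>j < i\<close> have "\<not> Suc i dvd Suc j"
      by (intro nat_dvd_not_less) simp_all
    ultimately show "D_mat n a $$ (i, j) = 0"
      by (simp add: D_mat_def)
  qed
  then have "det (D_mat n a) = prod_list (diag_mat (D_mat n a))"
    by (rule det_upper_triangular[OF _ D_mat_carrier])
  also have "diag_mat (D_mat n a) = map (\<lambda>_. a 1) [0..<n]"
    unfolding diag_mat_def by (intro map_cong) (simp_all add: D_mat_def)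
  finally show ?thesis
    by (simp add: map_replicate_const)
qed

lemma det_W_mat_plus_D_mat:
  assumes "n \<ge> 1" "a 1 = 1" "is_dirichlet_inverse a b" "w 1 = 1"
  shows "det (W_mat n w + D_mat n a) = (\<Sum>k=1..n. w k * b k)"
proof -
  have b1: "b 1 = 1"
    using assms is_dirichlet_inverse_alt by blast
  define M where "M = D_mat n b * W_mat n w + 1\<^sub>m n"
  have "D_mat n b * (W_mat n w + D_mat n a) = D_mat n b * W_mat n w + D_mat n b * D_mat n a"
    by (rule mult_add_distrib_mat[OF D_mat_carrier W_mat_carrier D_mat_carrier])
  also have "D_mat n b * D_mat n a = 1\<^sub>m n"
    using assms(3) by (simp add: D_mat_mult_inverse is_dirichlet_inverse_sym)
  finally have "det M = det (D_mat n b) * det (W_mat n w + D_mat n a)"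
    unfolding M_def by (metis D_mat_carrier W_mat_carrier add_carrier_mat det_mult)
  then have "det (W_mat n w + D_mat n a) = det M"
    using b1 by (simp add: det_D_mat)
  \<comment> \<open>\<open>D_mat n b * W_mat n w\<close> is zero outside column 0, so above the
    diagonal M agrees with the identity.\<close>
  also have "det M = prod_list (diag_mat M)"
    by (rule det_lower_triangular[where n = n])
      (auto simp: M_def W_mat_def D_mat_def scalar_prod_def)
  also have "\<dots> = (\<Prod>i = 0..<n. M $$ (i, i))"
    by (simp add: prod_list_diag_prod M_def W_mat_def)
  also have "\<dots> = M $$ (0, 0) * (\<Prod>i = 1..<n. M $$ (i, i))"
    using assms(1) by (simp add: prod.atLeast_Suc_lessThan)
  also have "(\<Prod>i = 1..<n. M $$ (i, i)) = 1"
    by (rule prod.neutral) (auto simp: M_def W_mat_def D_mat_def scalar_prod_def)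
  \<comment> \<open>Since 1 divides everything, the top row of \<open>D_mat n b\<close> lists b 1,
    ..., b n; it meets the only nonzero column of W. The leading 1 comes from the identity
    matrix.\<close>
  also have "M $$ (0, 0) = 1 + (\<Sum>k = 0..<n. b (Suc k) * (if k \<noteq> 0 then w (Suc k) else 0))"
    using assms(1) by (simp add: M_def W_mat_def D_mat_def scalar_prod_def)
  \<comment> \<open>W has 0 in its corner, so the k = 0 term is missing from the sum; the leading 1
    supplies it, because w 1 = b 1 = 1.\<close>
  also have "\<dots> = w 1 * b 1 + (\<Sum>k = 1..<n. w (Suc k) * b (Suc k))"
    using assms(1,4) b1 by (simp add: sum.atLeast_Suc_lessThan mult.commute)
  also have "\<dots> = (\<Sum>k = 0..<n. w (Suc k) * b (Suc k))"
    using assms(1) by (simp add: sum.atLeast_Suc_lessThan)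
  also have "\<dots> = (\<Sum>k=1..n. w k * b k)"
    by (rule sum.reindex_bij_witness[where i = "\<lambda>k. k - 1" and j = Suc]) auto
  finally show ?thesis by simp
qed

text \<open>A left inverse E and a right inverse \<open>D_mat n b\<close> of the same matrix
  coincide. This gives the value of \<open>the\<close> in the second determinant.\<close>

lemma mat_inverse_D_mat_eq:
  assumes "a 1 = 1" "is_dirichlet_inverse a b"
  shows "mat_inverse (D_mat n a) = Some (D_mat n b)"
proof -
  obtain E where E: "mat_inverse (D_mat n a) = Some E" "E \<in> carrier_mat n n"
    "E * D_mat n a = 1\<^sub>m n"
    using mat_inverse_D_mat[of a n] assms(1) by blast
  have "E = E * (D_mat n a * D_mat n b)"
    using E(2) by (simp add: D_mat_mult_inverse[OF assms(2)])
  also have "\<dots> = E * D_mat n a * D_mat n b"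
    using E(2) by (simp add: assoc_mult_mat[of _ n n _ n _ n])
  also have "\<dots> = D_mat n b"
    using E(3) left_mult_one_mat[OF D_mat_carrier] by simp
  finally show ?thesis using E(1) by simp
qed

theorem theorem2p1:
  fixes n :: nat and a b w :: "nat \<Rightarrow> complex"
  assumes "n \<ge> 1"
    and "a 1 = 1"
    and "is_dirichlet_inverse a b"
    and "w 1 = 1"
  shows "det (W_mat n w + D_mat n a) = (\<Sum>k=1..n. w k * b k) \<and>
         det (W_mat n w + the (mat_inverse (D_mat n a))) = (\<Sum>k=1..n. w k * a k)"
proof
  show "det (W_mat n w + D_mat n a) = (\<Sum>k=1..n. w k * b k)"
    using assms by (rule det_W_mat_plus_D_mat)
  \<comment> \<open>With a and b exchanged, this takes the place of the normalization of a.\<close>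
  have "b 1 = 1"
    using assms is_dirichlet_inverse_alt by blast
  moreover have "is_dirichlet_inverse b a"
    using assms(3) by (simp add: is_dirichlet_inverse_sym)
  ultimately show "det (W_mat n w + the (mat_inverse (D_mat n a))) = (\<Sum>k=1..n. w k * a k)"
    using assms by (simp add: mat_inverse_D_mat_eq det_W_mat_plus_D_mat)
qed

end
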